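(* Let $\mathcal{A}$ be a finite set, let $q \geq 2$ be an integer, and let $(U(n))_{n \geq 0}$ be a sequence with values in $\mathcal{A}$. Put $N = \frac{q^{t+1}-1}{q-1}$. Suppose that there exist four nonnegative integers $t, a, b, n_0$ and $q^{t+1}$ functions $f_0, f_1, \ldots, f_{q^{t+1}-1} : \mathcal{A}^{a+b+N} \to \mathcal{A}$ such that for all $j \in [0, q^{t+1}-1]$ and all $n \geq n_0$, $$U(q^{t+1}n+j) = f_j\big(U^{-a}(n), \ldots, U^{-1}(n), U^0(n), U^{1}(n), \ldots, U^b(n), U_2(n), U_3(n), \ldots, U_{N}(n)\big),$$ where $U_1 = U, U_2, \ldots, U_N$ are the $N$ subsequences $(U(q^i n + j'))_{n \geq 0}$ with $i \in [0,t]$ and $j' \in [0, q^i-1]$, listed in some fixed order (with $U_1 = U$). Then the sequence $(U(n))_{n \geq 0}$ is $q$-automatic.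
   Context: For a sequence $W = (W(n))_{n\ge 0}$ and an integer $\alpha \in \mathbb{Z}$, $W^{\alpha}$ denotes the sequence defined for $n \geq -\alpha$ by $W^{\alpha}(n) := W(n+\alpha)$. Convention: if a sequence is only defined for $n \geq c$ (for some integer $c \ge 0$), its values for $n \in [0,c)$ are taken to be arbitrary. A sequence $(U(n))_{n\ge 0}$ with values in a finite set is $q$-automatic if there is a deterministic finite automaton with output that, on reading the base-$q$ representation of $n$, outputs $U(n)$; equivalently, its $q$-kernel $\{(U(q^e n + r))_{n \geq 0} : e \geq 0,\ 0 \leq r < q^e\}$ is finite. *)

theory Defs
  imports Main "HOL-Library.FuncSet"
begin

(* Canonical representation, most significant digit first; 0 is the empty word.
   The disjunct "q < 2" only serves to make the recursion terminate. *)
fun base_repr :: "nat \<Rightarrow> nat \<Rightarrow> nat list" where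
  "base_repr q n = (if n = 0 \<or> q < 2 then [] else base_repr q (n div q) @ [n mod q])"

declare base_repr.simps [simp del]

record ('s, 'a) dfao =
  states :: "'s set"
  init :: 's
  trans :: "'s \<Rightarrow> nat \<Rightarrow> 's"
  out :: "'s \<Rightarrow> 'a"

definition is_dfao :: "nat \<Rightarrow> ('s, 'a) dfao \<Rightarrow> bool" where
  "is_dfao q M \<longleftrightarrow>
     finite (states M) \<and> init M \<in> states M \<and>
     (\<forall>s \<in> states M. \<forall>d < q. trans M s d \<in> states M)"

definition dfao_output :: "('s, 'a) dfao \<Rightarrow> nat list \<Rightarrow> 'a" where
  "dfao_output M w = out M (foldl (trans M) (init M) w)"

(* States are natural numbers without loss of generality: the state set is finite,
   and a definition cannot quantify over the type of states. *)
definition automatic :: "nat \<Rightarrow> (nat \<Rightarrow> 'a) \<Rightarrow> bool" where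
  "automatic q U \<longleftrightarrow>
     (\<exists>M :: (nat, 'a) dfao. is_dfao q M \<and> (\<forall>n. dfao_output M (base_repr q n) = U n))"

(* S is the shifted sequence W^\<alpha>, i.e. S n = W (n + \<alpha>) wherever n + \<alpha> \<ge> 0;
   at the finitely many remaining n its values are arbitrary elements of A. *)
definition is_shift :: "'a set \<Rightarrow> (nat \<Rightarrow> 'a) \<Rightarrow> int \<Rightarrow> (nat \<Rightarrow> 'a) \<Rightarrow> bool" where
  "is_shift A W \<alpha> S \<longleftrightarrow>
     (\<forall>n. S n \<in> A) \<and> (\<forall>n. int n \<ge> - \<alpha> \<longrightarrow> S n = W (nat (int n + \<alpha>)))"

(* The Cartesian power A^m, with tuples as lists of length m. *)
definition tuples :: "'a set \<Rightarrow> nat \<Rightarrow> 'a list set" where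
  "tuples A m = {xs. length xs = m \<and> set xs \<subseteq> A}"

definition subseq_of :: "nat \<Rightarrow> (nat \<Rightarrow> 'a) \<Rightarrow> nat \<times> nat \<Rightarrow> nat \<Rightarrow> 'a" where
  "subseq_of q U = (\<lambda>(i, j') n. U (q ^ i * n + j'))"

(* enum lists the N index pairs (i, j') with i in [0, t], j' in [0, q^i - 1] as
   enum 1, ..., enum N, so that U_k = subseq_of q U (enum k); the first pair is
   (0, 0), which gives U_1 = U. *)
definition is_listing :: "nat \<Rightarrow> nat \<Rightarrow> nat \<Rightarrow> (nat \<Rightarrow> nat \<times> nat) \<Rightarrow> bool" where
  "is_listing q t N enum \<longleftrightarrow>
     bij_betw enum {1..N} (SIGMA i:{0..t}. {0..q ^ i - 1}) \<and> enum 1 = (0, 0)"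

end

theory Submission
  imports Defs
begin

text \<open>
  For large n, let the state of n record the values \<open>U (q ^ i * (n + d) + r)\<close> with \<open>i \<le> t\<close>, \<open>r < q ^ i\<close>
  and \<open>- 2 * a \<le> d \<le> 2 * b + 1\<close>. This window is chosen so that the state of n determines
  the state of \<open>q * n + s\<close> for every digit s: an entry with \<open>i < t\<close> becomes an entry of level
  \<open>i + 1\<close>, and an entry with \<open>i = t\<close> is rewritten by the recurrence at a point \<open>n + d\<close> with
  \<open>- a \<le> d \<le> b + 1\<close>, whose arguments all lie in the window of n. There are finitely many
  states, and finitely many small n can be remembered exactly, so a finite automaton can track
  the state of the prefix read so far.
\<close>

text \<open>The values of \<open>V\<close> serve as states, renamed by an injection into the
  naturals because \<open>automatic\<close> fixes that state type. By \<open>step\<close>, a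
  transition computed at a chosen representative agrees with the one at the actual prefix.\<close>

lemma automatic_if_finite_determined:
  fixes V :: "nat \<Rightarrow> 's" and U :: "nat \<Rightarrow> 'a"
  assumes "q \<ge> 2" and "finite (range V)"
    and step: "\<And>m n d. V m = V n \<Longrightarrow> d < q \<Longrightarrow> V (q * m + d) = V (q * n + d)"
    and out: "\<And>m n. V m = V n \<Longrightarrow> U m = U n"
  shows "automatic q U"
proof -
  obtain h :: "'s \<Rightarrow> nat" where h: "inj_on h (range V)"
    using finite_imp_inj_to_nat_seg[OF \<open>finite (range V)\<close>] by metis
  define W where "W n = h (V n)" for n
  have W: "W m = W n \<longleftrightarrow> V m = V n" for m n
    using h by (auto simp: W_def inj_on_def)
  define rep where "rep c = (SOME n. W n = c)" for c
  have rep: "V (rep (W n)) = V n" for n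
    unfolding W[symmetric] rep_def by (rule someI) simp
  define M :: "(nat, 'a) dfao" where
    "M = \<lparr>states = range W, init = W 0, trans = (\<lambda>c d. W (q * rep c + d)), out = (\<lambda>c. U (rep c))\<rparr>"
  have "finite (range W)"
    using \<open>finite (range V)\<close> by (simp add: W_def flip: image_image)
  then have dfao: "is_dfao q M"
    by (auto simp: is_dfao_def M_def)
  have run: "foldl (trans M) (init M) (base_repr q n) = W n" for n
  proof (induction n rule: less_induct)
    case (less n)
    show ?case
    proof (cases "n = 0")
      case True
      then show ?thesis by (simp add: base_repr.simps M_def)
    next
      case False
      have "foldl (trans M) (init M) (base_repr q n) = trans M (W (n div q)) (n mod q)"
        using False \<open>q \<ge> 2\<close> less.IH[of "n div q"] by (subst base_repr.simps) simp
      also have "\<dots> = W (q * (n div q) + n mod q)"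
        using \<open>q \<ge> 2\<close> by (simp add: M_def W step rep)
      finally show ?thesis by simp
    qed
  qed
  have "dfao_output M (base_repr q n) = U n" for n
    using out[OF rep, of n] unfolding dfao_output_def run by (simp add: M_def)
  with dfao show ?thesis
    unfolding automatic_def by blast
qed

text \<open>Pairing \<open>V\<close> with \<open>min n K\<close> reduces this to the previous lemma:
  a first component below \<open>K\<close> determines n, and one equal to \<open>K\<close> stays so
  when a digit is appended.\<close>

lemma automatic_if_eventually_determined:
  fixes V :: "nat \<Rightarrow> 's" and U :: "nat \<Rightarrow> 'a"
  assumes "q \<ge> 2" and "finite (range V)"
    and step: "\<And>m n d. m \<ge> K \<Longrightarrow> n \<ge> K \<Longrightarrow> V m = V n \<Longrightarrow> d < q \<Longrightarrow> V (q * m + d) = V (q * n + d)"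
    and out: "\<And>m n. m \<ge> K \<Longrightarrow> n \<ge> K \<Longrightarrow> V m = V n \<Longrightarrow> U m = U n"
  shows "automatic q U"
proof (rule automatic_if_finite_determined[where V = "\<lambda>n. (min n K, V n)"])
  have "range (\<lambda>n. (min n K, V n)) \<subseteq> {..K} \<times> range V" by auto
  then show "finite (range (\<lambda>n. (min n K, V n)))"
    by (rule finite_subset) (simp add: \<open>finite (range V)\<close>)
next
  fix m n d assume "(min m K, V m) = (min n K, V n)" and "d < q"
  then consider "m = n" | "m \<ge> K" "n \<ge> K" "V m = V n"
    by (auto simp: min_def split: if_splits)
  then show "(min (q * m + d) K, V (q * m + d)) = (min (q * n + d) K, V (q * n + d))"
  proof cases
    case 2
    have "K \<le> q * k + d" if "K \<le> k" for k
    proof -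
      have "1 * k \<le> q * k" using \<open>q \<ge> 2\<close> by (intro mult_le_mono1) simp
      then show ?thesis using that by linarith
    qed
    then show ?thesis using 2 step[OF 2 \<open>d < q\<close>] by (simp add: min_absorb2)
  qed simp
next
  fix m n assume "(min m K, V m) = (min n K, V n)"
  then have "m = n \<or> m \<ge> K \<and> n \<ge> K \<and> V m = V n"
    by (auto simp: min_def split: if_splits)
  then show "U m = U n"
    using out by blast
qed (fact \<open>q \<ge> 2\<close>)

lemma mult_add_less_mult:
  fixes x y m n :: nat
  assumes "x < m" and "y < n"
  shows "m * y + x < m * n"
proof -
  have "m * y + x < m * Suc y" using assms by simp
  also have "\<dots> \<le> m * n" using assms by (intro mult_le_mono2) simp
  finally show ?thesis .
qed

theorem theorem2:
  fixes A :: "'a set" and U :: "nat \<Rightarrow> 'a"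
    and q t a b n0 N :: nat
    and f :: "nat \<Rightarrow> 'a list \<Rightarrow> 'a"
    and enum :: "nat \<Rightarrow> nat \<times> nat"
    and S :: "int \<Rightarrow> nat \<Rightarrow> 'a"
  assumes "finite A"
    and "q \<ge> 2"
    and "\<forall>n. U n \<in> A"
    and "N = (q ^ (t + 1) - 1) div (q - 1)"
    and "is_listing q t N enum"
    and "\<forall>\<alpha> \<in> {- int a..int b}. is_shift A U \<alpha> (S \<alpha>)"
    and "\<forall>j \<in> {0..q ^ (t + 1) - 1}. f j \<in> tuples A (a + b + N) \<rightarrow> A"
    and "\<forall>j \<in> {0..q ^ (t + 1) - 1}. \<forall>n \<ge> n0.
           U (q ^ (t + 1) * n + j) =
             f j (map (\<lambda>\<alpha>. S \<alpha> n) [- int a..int b] @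
                  map (\<lambda>k. subseq_of q U (enum k) n) [2..<N + 1])"
  shows "automatic q U"
proof -
  note fin = assms(1) and q2 = assms(2) and UA = assms(3) and rec = assms(8)
  define I where "I = (SIGMA i:{..t}. {..2 * a + 2 * b + 1} \<times> {..<q ^ i})"
  \<comment> \<open>The left end of the window is \<open>n - 2 * a\<close>, so k = \<open>n - 2 * a\<close> and entries are indexed by e = \<open>d + 2 * a\<close>.\<close>
  define C where "C k = restrict (\<lambda>(i, e, r). U (q ^ i * (k + e) + r)) I" for k
  have C_eqD: "U (q ^ i * (k + e) + r) = U (q ^ i * (l + e) + r)"
    if "C k = C l" "i \<le> t" "e \<le> 2 * a + 2 * b + 1" "r < q ^ i" for k l i e r
    using fun_cong[OF \<open>C k = C l\<close>, of "(i, e, r)"] that by (simp add: C_def I_def)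
  \<comment> \<open>These bounds on \<open>e\<close> leave \<open>a\<close> places to its left and
    \<open>b\<close> to its right inside the window, enough for every shift in the
    recurrence.\<close>
  have args: "U (q ^ (t + 1) * (k + e) + j) = U (q ^ (t + 1) * (l + e) + j)"
    if eq: "C k = C l" and k: "k \<ge> n0" and l: "l \<ge> n0"
      and e: "a \<le> e" "e \<le> 2 * a + b + 1" and j: "j < q ^ (t + 1)" for k l e j
  proof -
    have shifts: "S \<alpha> (k + e) = S \<alpha> (l + e)" if \<alpha>: "- int a \<le> \<alpha>" "\<alpha> \<le> int b" for \<alpha>
    proof -
      define e' where "e' = nat (int e + \<alpha>)"
      \<comment> \<open>Since \<open>a \<le> e\<close>, the shifted index is never negative, so the
        arbitrary values of the shift do not enter.\<close>
      have S: "S \<alpha> (p + e) = U (p + e')" for p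
      proof -
        have "nat (int (p + e) + \<alpha>) = p + e'" and "int (p + e) \<ge> - \<alpha>"
          using \<alpha> e by (auto simp: e'_def)
        moreover have "is_shift A U \<alpha> (S \<alpha>)" using assms(6) \<alpha> by simp
        ultimately show ?thesis by (simp add: is_shift_def)
      qed
      have "e' \<le> 2 * a + 2 * b + 1" using \<alpha> e by (simp add: e'_def nat_le_iff)
      then show ?thesis using C_eqD[OF eq, of 0 e' 0] by (simp add: S)
    qed
    have subs: "subseq_of q U (enum x) (k + e) = subseq_of q U (enum x) (l + e)"
      if "x \<in> {1..N}" for x
    proof -
      obtain i r where ir: "enum x = (i, r)" by fastforce
      have "enum x \<in> (SIGMA i:{0..t}. {0..q ^ i - 1})"
        using assms(5) that unfolding is_listing_def by (meson bij_betw_apply)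
      moreover have "q ^ i > 0" using q2 by simp
      ultimately have "i \<le> t" "r < q ^ i"
        unfolding ir mem_Sigma_iff atLeastAtMost_iff by linarith+
      then show ?thesis
        using C_eqD[OF eq, of i e r] e by (simp add: subseq_of_def ir)
    qed
    have "j \<in> {0..q ^ (t + 1) - 1}" using j by auto
    then have rec': "U (q ^ (t + 1) * (p + e) + j) =
             f j (map (\<lambda>\<alpha>. S \<alpha> (p + e)) [- int a..int b] @
                  map (\<lambda>x. subseq_of q U (enum x) (p + e)) [2..<N + 1])" if "p \<ge> n0" for p
      using rec that by auto
    have "map (\<lambda>\<alpha>. S \<alpha> (k + e)) [- int a..int b] = map (\<lambda>\<alpha>. S \<alpha> (l + e)) [- int a..int b]"
      using shifts by simp
    moreover have "map (\<lambda>x. subseq_of q U (enum x) (k + e)) [2..<N + 1] =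
        map (\<lambda>x. subseq_of q U (enum x) (l + e)) [2..<N + 1]"
      using subs by auto
    ultimately show ?thesis
      unfolding rec'[OF k] rec'[OF l]
      by (intro arg_cong[where f = "f j"] arg_cong2[where f = "(@)"])
  qed
  have level_Suc: "U (q ^ i * (q * k + E) + r) = U (q ^ i * (q * l + E) + r)"
    if eq: "C k = C l" and k: "k \<ge> n0" and l: "l \<ge> n0" and i: "i \<le> t" and r: "r < q ^ i"
      and E: "a \<le> E div q" "E div q \<le> 2 * a + b + 1" for k l i r E
  proof -
    \<comment> \<open>The quotient of \<open>E\<close> by \<open>q\<close> moves the window point;
      the remainder becomes the leading digit of a residue at level \<open>i + 1\<close>.\<close>
    define r' where "r' = q ^ i * (E mod q) + r"
    have r': "r' < q ^ (i + 1)"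
      using mult_add_less_mult[OF r, of "E mod q" q] q2 by (simp add: r'_def mult.commute)
    have split: "q ^ i * (q * p + E) + r = q ^ (i + 1) * (p + E div q) + r'" for p
    proof -
      have "q ^ i * (q * p + E) = q ^ i * (q * p + (q * (E div q) + E mod q))"
        by (simp only: mult_div_mod_eq)
      then show ?thesis
        by (simp only: r'_def power_add power_one_right distrib_left mult_ac add_ac)
    qed
    show ?thesis
    proof (cases "i = t")
      \<comment> \<open>Level \<open>t + 1\<close> is not stored in the window, so the recurrence
        supplies it.\<close>
      case True
      show ?thesis using r' unfolding split unfolding True by (rule args[OF eq k l E])
    next
      case False
      then have "i + 1 \<le> t" and "E div q \<le> 2 * a + 2 * b + 1" using i E by simp_all
      then show ?thesis using r' unfolding split by (rule C_eqD[OF eq])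
    qed
  qed
  show ?thesis
  \<comment> \<open>From this \<open>K\<close> on, \<open>n - 2 * a\<close> is not truncated and is
    at least \<open>n0\<close>.\<close>
  proof (rule automatic_if_eventually_determined[where V = "\<lambda>n. C (n - 2 * a)" and K = "n0 + 2 * a"])
    have "range (\<lambda>n. C (n - 2 * a)) \<subseteq> PiE I (\<lambda>_. A)"
      using UA by (auto simp: C_def)
    moreover have "finite (PiE I (\<lambda>_. A))"
      using fin by (intro finite_PiE) (auto simp: I_def)
    ultimately show "finite (range (\<lambda>n. C (n - 2 * a)))" by (rule finite_subset)
  next
    fix m n s
    assume K: "m \<ge> n0 + 2 * a" "n \<ge> n0 + 2 * a" and eq: "C (m - 2 * a) = C (n - 2 * a)" and s: "s < q"
    have "U (q ^ i * (q * m + s - 2 * a + e) + r) = U (q ^ i * (q * n + s - 2 * a + e) + r)"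
      if "i \<le> t" and e: "e \<le> 2 * a + 2 * b + 1" and "r < q ^ i" for i e r
    proof -
      \<comment> \<open>Offset of the entry relative to \<open>q * (p - 2 * a)\<close>, as the
        window of \<open>q * p + s\<close> starts at \<open>q * p + s - 2 * a\<close>.\<close>
      define E where "E = 2 * a * (q - 1) + s + e"
      define c where "c = q - 2"
      then have c: "q = c + 2" using q2 by simp
      have pos: "q * p + s - 2 * a + e = q * (p - 2 * a) + E" if "p \<ge> n0 + 2 * a" for p
      proof -
        define p' where "p' = p - 2 * a"
        then have "p = p' + 2 * a" using that by simp
        then show ?thesis by (simp add: E_def c algebra_simps)
      qed
      \<comment> \<open>This is where the left margin \<open>2 * a\<close> is needed:
        \<open>q \<ge> 2\<close> gives \<open>a * q \<le> 2 * a * (q - 1)\<close>.\<close>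
      have "a * q \<le> E" by (simp add: E_def c algebra_simps)
      then have lo: "a \<le> E div q" using q2 by (simp add: less_eq_div_iff_mult_less_eq)
      \<comment> \<open>At most, \<open>E\<close> is \<open>2 * a * q + q + 2 * b\<close>, and
        \<open>2 * b \<le> b * q\<close>.\<close>
      have "E < (2 * a + b + 2) * q" using e s by (simp add: E_def c algebra_simps)
      then have "E div q < 2 * a + b + 2" using q2 by (simp add: div_less_iff_less_mult)
      then have hi: "E div q \<le> 2 * a + b + 1" by simp
      show ?thesis
        unfolding pos[OF K(1)] pos[OF K(2)]
        using K lo hi that by (intro level_Suc[OF eq]) auto
    qed
    then show "C (q * m + s - 2 * a) = C (q * n + s - 2 * a)"
      by (auto simp: C_def I_def intro!: restrict_ext)
  next
    fix m n
    assume "m \<ge> n0 + 2 * a" "n \<ge> n0 + 2 * a" and eq: "C (m - 2 * a) = C (n - 2 * a)"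
    \<comment> \<open>Entry \<open>2 * a\<close> of level 0 is the value at displacement 0.\<close>
    then show "U m = U n" using C_eqD[OF eq, of 0 "2 * a" 0] by simp
  qed (fact q2)
qed

end
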